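(* If the statement $\Phi_5$ holds, then there are infinitely many twin primes, i.e. infinitely many primes $p$ such that $p-2$ or $p+2$ is also prime.
   Context: Define $f:\{1,2,3,\ldots\}\to\mathbb{N}$ by $f(1)=2$, $f(2)=3$, and $f(n+1)=f(n)!$ for every integer $n\geqslant 2$. Write $x\not\mid y$ to mean that $x$ does not divide $y$. For a positive integer $n$, $\Phi_n$ denotes the statement: for every system $\mathcal{S}$ that is a subset of $\{x_i+1=x_k,\ x_i!=x_k,\ x_i\not\mid x_k : i,k\in\{1,\ldots,n\}\}$, if $\mathcal{S}$ has only finitely many solutions in positive integers $x_1,\ldots,x_n$, then every such solution $(x_1,\ldots,x_n)$ satisfies $x_1,\ldots,x_n\leqslant f(n)$. *)

theory Defs
  imports "HOL-Library.FuncSet" "HOL-Computational_Algebra.Primes"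
begin

text \<open>The value at \<open>0\<close> is a dummy: the function is only meant for arguments \<open>n \<ge> 1\<close>.\<close>

fun bound_f :: "nat \<Rightarrow> nat" where
  "bound_f 0 = 0"
| "bound_f (Suc 0) = 2"
| "bound_f (Suc (Suc 0)) = 3"
| "bound_f (Suc (Suc (Suc n))) = fact (bound_f (Suc (Suc n)))"

text \<open>Formal constraints \<open>x\<^sub>i + 1 = x\<^sub>k\<close>, \<open>x\<^sub>i! = x\<^sub>k\<close> and \<open>\<not> x\<^sub>i dvd x\<^sub>k\<close>;
  the arguments are the variable indices \<open>i\<close> and \<open>k\<close>.\<close>

datatype constr = SuccEq nat nat | FactEq nat nat | NotDvd nat nat

fun holds :: "(nat \<Rightarrow> nat) \<Rightarrow> constr \<Rightarrow> bool" where
  "holds x (SuccEq i k) \<longleftrightarrow> x i + 1 = x k"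
| "holds x (FactEq i k) \<longleftrightarrow> fact (x i) = x k"
| "holds x (NotDvd i k) \<longleftrightarrow> \<not> x i dvd x k"

definition constrs :: "nat \<Rightarrow> constr set" where
  "constrs n = (\<Union>i\<in>{1..n}. \<Union>k\<in>{1..n}. {SuccEq i k, FactEq i k, NotDvd i k})"

text \<open>An \<open>n\<close>-tuple of positive integers is an element of \<open>{1..n} \<rightarrow>\<^sub>E {1..}\<close>. Fixing the values
  outside \<open>{1..n}\<close> is essential here, since solutions are counted.\<close>

definition solutions :: "nat \<Rightarrow> constr set \<Rightarrow> (nat \<Rightarrow> nat) set" where
  "solutions n S = {x \<in> {1..n} \<rightarrow>\<^sub>E {1..}. \<forall>c\<in>S. holds x c}"

definition Phi :: "nat \<Rightarrow> bool" where
  "Phi n \<longleftrightarrow> (\<forall>S. S \<subseteq> constrs n \<longrightarrow> finite (solutions n S) \<longrightarrow>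
     (\<forall>x\<in>solutions n S. \<forall>i\<in>{1..n}. x i \<le> bound_f n))"

end

theory Submission imports Defs begin

text \<open>Composite numbers \<open>n \<ge> 6\<close> divide \<open>(n - 3)!\<close>, so the five variables
  \<open>p - 1, (p - 1)!, p, p + 1, p + 2\<close> suffice to say that \<open>p\<close> and \<open>p + 2\<close> are both prime: neither
  divides \<open>(p - 1)!\<close> (with finitely many exceptions). The twin primes 809 and 811 give a solution
  containing \<open>808!\<close>, which exceeds \<open>f(5) = 720!\<close>, so \<open>\<Phi>\<^sub>5\<close> forces infinitely many solutions.\<close>

lemma mult_dvd_fact:
  fixes a b :: nat
  assumes "0 < a" "a < b"
  shows "a * b dvd fact b"
proof -
  obtain c where c: "b = Suc c" "a \<le> c"
    using assms by (cases b) auto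
  have "a dvd fact c"
    using assms(1) c(2) by (intro dvd_fact) auto
  then have "a * b dvd fact c * b"
    by (rule mult_dvd_mono) simp
  then show ?thesis
    by (simp add: c(1) mult.commute)
qed

text \<open>A nontrivial factorization of n puts its factors, or a and 2a if n = a^2, among 1, ...,
  n - 3. The offset 3 fits n = p + 2, where (n - 3)! = (p - 1)!; the bound 6 excludes n = 4, which
  does not divide 1!.\<close>

lemma composite_dvd_fact_minus_3:
  fixes n :: nat
  assumes "6 \<le> n" "\<not> prime n"
  shows "n dvd fact (n - 3)"
proof -
  obtain d where d: "d dvd n" "d \<noteq> 1" "d \<noteq> n"
    using assms by (auto simp: prime_nat_iff)
  define a b where "a = min d (n div d)" and "b = max d (n div d)"
  have "d * (n div d) = n"
    using d(1) by simp
  then have ab: "a * b = n" "a \<le> b"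
    unfolding a_def b_def by (auto simp: min_def max_def mult.commute)
  have "n div d \<noteq> 1" "n div d \<noteq> 0" "d \<noteq> 0"
    using \<open>d * (n div d) = n\<close> d(3) assms(1) by (auto intro: Nat.gr0I)
  then have "2 \<le> a"
    using d(2) unfolding a_def by simp
  show ?thesis
  proof (cases "a = b")
    case False
    with ab \<open>2 \<le> a\<close> have "n dvd fact b"
      using mult_dvd_fact[of a b] by simp
    \<comment> \<open>As a \<ge> 2, b is at most n/2, and n/2 \<le> n - 3 because n \<ge> 6.\<close>
    moreover have "2 * b \<le> n"
      using mult_le_mono1[OF \<open>2 \<le> a\<close>, of b] ab by simp
    then have "b \<le> n - 3"
      using assms(1) by linarith
    ultimately show ?thesis
      by (meson dvd_trans fact_dvd)
  next
    case True
    have "a \<noteq> 2"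
      using True ab assms(1) by auto
    then have "3 \<le> a"
      using \<open>2 \<le> a\<close> by simp
    then have "3 * a \<le> n"
      using mult_le_mono1[of 3 a a] ab(1) unfolding True by metis
    then have "2 * a \<le> n - 3"
      using \<open>3 \<le> a\<close> by linarith
    \<comment> \<open>For the square n = a * a, the distinct factors a and 2a of (2a)! have product
      2n.\<close>
    moreover have "a * (2 * a) dvd fact (2 * a)"
      using \<open>3 \<le> a\<close> by (intro mult_dvd_fact) auto
    then have "n dvd fact (2 * a)"
      using ab True by (metis dvd_mult_left mult.assoc mult.left_commute mult.commute)
    ultimately show ?thesis
      by (meson dvd_trans fact_dvd)
  qed
qed

lemma bound_f_5: "bound_f 5 = fact 720"
proof -
  have "bound_f 3 = 6"
    by (simp add: numeral_3_eq_3 fact_numeral)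
  moreover have "bound_f 4 = fact (bound_f 3)" "bound_f 5 = fact (bound_f 4)"
    using bound_f.simps(4)[of 1] bound_f.simps(4)[of 2]
    by (simp_all only: Suc_1 flip: numeral_3_eq_3, simp_all only: Suc_numeral semiring_norm)
  moreover have "fact 6 = (720 :: nat)"
    by (simp add: fact_numeral)
  ultimately show ?thesis
    by metis
qed

text \<open>Addition is only available in steps of one, so variable 4 is the link from p to p +
  2.\<close>

definition twin_system :: "constr set" where
  "twin_system =
    {FactEq 1 2, SuccEq 1 3, SuccEq 3 4, SuccEq 4 5, NotDvd 3 2, NotDvd 5 2}"

text \<open>Restricting to \<open>{1..5}\<close> makes the tuple extensional, as membership in
  \<open>solutions\<close> demands.\<close>

definition twin_tuple :: "nat \<Rightarrow> nat \<Rightarrow> nat" where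
  "twin_tuple p = (\<lambda>i\<in>{1..5}. [p - 1, fact (p - 1), p, p + 1, p + 2] ! (i - 1))"

lemma atLeastAtMost_1_5: "{1..5} = {1, 2, 3, 4, 5 :: nat}"
  by auto

lemma twin_tuple_simps:
  "twin_tuple p 1 = p - 1" "twin_tuple p 2 = fact (p - 1)" "twin_tuple p 3 = p"
  "twin_tuple p 4 = p + 1" "twin_tuple p 5 = p + 2"
  by (simp_all add: twin_tuple_def eval_nat_numeral)

lemma twin_system_subset: "twin_system \<subseteq> constrs 5"
  by (simp add: twin_system_def constrs_def atLeastAtMost_1_5)

lemma twin_tuple_in_solutions:
  assumes "prime p" "prime (p + 2)"
  shows "twin_tuple p \<in> solutions 5 twin_system"
proof -
  have "2 < p"
    using assms prime_ge_2_nat[of p] by (cases "p = 2") auto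
  then have "\<not> p dvd fact (p - 1)" "\<not> p + 2 dvd fact (p - 1)"
    using assms by (auto simp: prime_dvd_fact_iff)
  moreover have "twin_tuple p \<in> {1..5} \<rightarrow>\<^sub>E {1..}"
  proof (rule PiE_I)
    fix i :: nat assume "i \<in> {1..5}"
    then have "i = 1 \<or> i = 2 \<or> i = 3 \<or> i = 4 \<or> i = 5"
      by auto
    then show "twin_tuple p i \<in> {1..}"
      using \<open>2 < p\<close> by (elim disjE) (simp_all only: twin_tuple_simps, auto)
  qed (auto simp: twin_tuple_def)
  ultimately show ?thesis
    using \<open>2 < p\<close> unfolding solutions_def twin_system_def
    by (auto simp del: One_nat_def simp: twin_tuple_simps)
qed

text \<open>The equations determine every entry from \<open>x 3\<close>, so counting solutions
  amounts to counting values of \<open>x 3\<close>. Small values are set apart because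
  \<open>x 3 = 2\<close> is a spurious solution: 4 does not divide 1!.\<close>

lemma solutions_twin_systemD:
  assumes "x \<in> solutions 5 twin_system"
  shows "x = twin_tuple (x 3)" and "x 3 < 6 \<or> prime (x 3) \<and> prime (x 3 + 2)"
proof -
  have eqs: "fact (x 1) = x 2" "x 1 + 1 = x 3" "x 3 + 1 = x 4" "x 4 + 1 = x 5"
    and ndvd: "\<not> x 3 dvd x 2" "\<not> x 5 dvd x 2" and ext: "x \<in> extensional {1..5}"
    using assms unfolding solutions_def twin_system_def PiE_def
    by (auto simp del: One_nat_def)
  have x: "x 1 = x 3 - 1" "x 2 = fact (x 3 - 1)" "x 4 = x 3 + 1" "x 5 = x 3 + 2"
    using eqs by (auto simp flip: eqs)
  show "x = twin_tuple (x 3)"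
  proof (rule extensionalityI[OF ext])
    fix i :: nat assume "i \<in> {1..5}"
    then have "i = 1 \<or> i = 2 \<or> i = 3 \<or> i = 4 \<or> i = 5"
      by auto
    then show "x i = twin_tuple (x 3) i"
      by (elim disjE) (simp_all only: twin_tuple_simps x)
  qed (simp add: twin_tuple_def)
  show "x 3 < 6 \<or> prime (x 3) \<and> prime (x 3 + 2)"
  proof (cases "x 3 < 6")
    case False
    have "fact (x 3 - 3) dvd (fact (x 3 - 1) :: nat)"
      by (rule fact_dvd) simp
    then have "prime (x 3)"
      using composite_dvd_fact_minus_3[of "x 3"] False ndvd(1) x(2) by (metis dvd_trans not_less)
    \<comment> \<open>This is where the offset 3 is needed: a composite \<open>x 5\<close> would
      divide exactly the factorial \<open>x 2\<close>.\<close>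
    moreover have "x 3 + 2 - 3 = x 3 - 1"
      by simp
    then have "prime (x 3 + 2)"
      using composite_dvd_fact_minus_3[of "x 3 + 2"] False ndvd(2) x(2,4)
      by (metis not_less trans_le_add1)
    ultimately show ?thesis
      by simp
  qed simp
qed

text \<open>Since p \<ge> 2 for a prime p, the subtraction \<open>p - 2\<close> is never
  truncated.\<close>

theorem theorem4:
  assumes "Phi 5"
  shows "infinite {p :: nat. prime p \<and> (prime (p - 2) \<or> prime (p + 2))}"
proof
  assume fin: "finite {p :: nat. prime p \<and> (prime (p - 2) \<or> prime (p + 2))}"
  have "solutions 5 twin_system \<subseteq>
      twin_tuple ` ({..<6} \<union> {p. prime p \<and> (prime (p - 2) \<or> prime (p + 2))})"
  proof
    fix x assume "x \<in> solutions 5 twin_system"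
    from solutions_twin_systemD[OF this]
    show "x \<in> twin_tuple ` ({..<6} \<union> {p. prime p \<and> (prime (p - 2) \<or> prime (p + 2))})"
      by (intro image_eqI[of x twin_tuple "x 3"]) auto
  qed
  then have "finite (solutions 5 twin_system)"
    using fin by (meson finite_UnI finite_imageI finite_lessThan finite_subset)
  \<comment> \<open>The pair must satisfy p - 1 > 720 for (p - 1)! to exceed 720!; this is the
    smallest such pair.\<close>
  moreover have "prime (809 :: nat)" "prime (809 + 2 :: nat)"
    by simp_all
  then have "twin_tuple 809 \<in> solutions 5 twin_system"
    by (rule twin_tuple_in_solutions)
  ultimately have "twin_tuple 809 2 \<le> bound_f 5"
    using assms twin_system_subset unfolding Phi_def by force
  then have "fact (809 - 1) \<le> (fact 720 :: nat)"
    by (simp only: twin_tuple_simps bound_f_5)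
  moreover have "(fact 720 :: nat) < fact (809 - 1)"
    by (rule fact_less_mono) simp_all
  ultimately show False
    by (meson not_less)
qed

end
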